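(* Let $0\le q\le p\le 1$ and let $n\ge 0$ be an integer. The formal power series $$F_n(x)=\sum_{L=n+1}^\infty\begin{Bmatrix}L\\ n+1\end{Bmatrix}_{p,q}x^{L-n-1}$$ is given by $$F_n(x)=\prod_{j=0}^{n}\frac{1}{1-(1+jp+(n-j)q)\,x}.$$
   Context: $\Omega_{L,n}$ is the set of words $\tau=(\tau_1,\dots,\tau_L)$ with letters in $\{0,1,\hat 1\}$ containing exactly one $\hat 1$, exactly $n$ letters $1$ and $L-n-1$ letters $0$. For $\tau\in\Omega_{L,n}$ with $\tau_1=\hat 1$ set $$w(\tau)=\prod_{\substack{2\le i\le L\\ \tau_i=0}}\bigl(1+p\,m_i(\tau)+q\,n_i(\tau)\bigr),$$ where $m_i(\tau)$ (resp. $n_i(\tau)$) is the number of $1$'s among $\tau_2,\dots,\tau_{i-1}$ (resp. among $\tau_{i+1},\dots,\tau_L$). The restricted partition function is $$\begin{Bmatrix}L\\ n+1\end{Bmatrix}_{p,q}=\sum_{\tau\in\Omega_{L,n},\ \tau_1=\hat 1}w(\tau)\qquad(0\le n\le L-1).$$ *)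

theory Defs
  imports Complex_Main "HOL-Computational_Algebra.Formal_Power_Series"
begin

datatype letter = Zero | One | HatOne

type_synonym word = "letter list"

definition Omega :: "nat \<Rightarrow> nat \<Rightarrow> word set" where
  "Omega L n = {\<tau>. length \<tau> = L \<and> count_list \<tau> HatOne = 1 \<and>
     count_list \<tau> One = n \<and> count_list \<tau> Zero = L - n - 1}"

text \<open>Positions in a word are numbered from 1, list positions from 0.\<close>

definition letter_at :: "word \<Rightarrow> nat \<Rightarrow> letter" where
  "letter_at \<tau> i = \<tau> ! (i - 1)"

definition ones_before :: "word \<Rightarrow> nat \<Rightarrow> nat" where
  "ones_before \<tau> i = card {k \<in> {2..<i}. letter_at \<tau> k = One}"

definition ones_after :: "word \<Rightarrow> nat \<Rightarrow> nat" where
  "ones_after \<tau> i = card {k \<in> {i<..length \<tau>}. letter_at \<tau> k = One}"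

definition weight :: "real \<Rightarrow> real \<Rightarrow> word \<Rightarrow> real" where
  "weight p q \<tau> = (\<Prod>i \<in> {i \<in> {2..length \<tau>}. letter_at \<tau> i = Zero}.
     1 + p * real (ones_before \<tau> i) + q * real (ones_after \<tau> i))"

text \<open>The value at \<open>L\<close>, \<open>n\<close> is the bracket with upper entry \<open>L\<close> and lower entry \<open>n + 1\<close>.\<close>

definition restricted_pf :: "real \<Rightarrow> real \<Rightarrow> nat \<Rightarrow> nat \<Rightarrow> real" where
  "restricted_pf p q L n =
     (\<Sum>\<tau> \<in> {\<tau> \<in> Omega L n. letter_at \<tau> 1 = HatOne}. weight p q \<tau>)"

text \<open>The coefficient of \<open>x ^ k\<close> comes from the summand \<open>L = n + 1 + k\<close>.\<close>

definition F :: "real \<Rightarrow> real \<Rightarrow> nat \<Rightarrow> real fps" where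
  "F p q n = Abs_fps (\<lambda>k. restricted_pf p q (n + 1 + k) n)"

end

theory Submission
  imports Defs
begin

text \<open>
  Deleting the leading \<open>HatOne\<close> leaves an arbitrary word with \<open>n\<close> letters \<open>One\<close>, and a letter
  \<open>Zero\<close> preceded by \<open>j\<close> letters \<open>One\<close> contributes \<open>c j = 1 + j p + (n - j) q\<close>. The
  words are thus lattice paths in which a \<open>Zero\<close> at height \<open>j\<close> has weight \<open>c j\<close>. Splitting off
  the first letter shows that the generating function of the paths from height \<open>j\<close> to height
  \<open>j + n\<close> satisfies \<open>(1 - c j x) g j n = g (j + 1) (n - 1)\<close>.
\<close>

definition zero_one_words :: "nat \<Rightarrow> nat \<Rightarrow> word set" where
  "zero_one_words n k =
     {v. count_list v HatOne = 0 \<and> count_list v One = n \<and> count_list v Zero = k}"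

text \<open>The argument \<open>j\<close> is the current height. Keeping the start free is what
  makes the recursion on the first letter close up.\<close>

primrec path_weight :: "(nat \<Rightarrow> 'a::comm_semiring_1) \<Rightarrow> nat \<Rightarrow> word \<Rightarrow> 'a" where
  "path_weight c j [] = 1"
| "path_weight c j (x # v) =
     (if x = Zero then c j else 1) * path_weight c (if x = One then Suc j else j) v"

lemma length_word:
  "length v = count_list v HatOne + count_list v One + count_list v Zero"
proof (induction v)
  case (Cons x v)
  then show ?case by (cases x) auto
qed simp

lemma finite_zero_one_words: "finite (zero_one_words n k)"
proof (rule finite_subset)
  have "set v \<subseteq> {Zero, One, HatOne}" for v
    using letter.exhaust by blast
  then show "zero_one_words n k \<subseteq> {v. set v \<subseteq> {Zero, One, HatOne} \<and> length v = n + k}"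
    by (auto simp: zero_one_words_def length_word)
qed (simp add: finite_lists_length_eq)

lemma zero_one_words_rec:
  "zero_one_words n k = (if n = 0 \<and> k = 0 then {[]} else
     (if k = 0 then {} else (#) Zero ` zero_one_words n (k - 1)) \<union>
     (if n = 0 then {} else (#) One ` zero_one_words (n - 1) k))"
proof (rule set_eqI)
  show "v \<in> zero_one_words n k \<longleftrightarrow> v \<in> (if n = 0 \<and> k = 0 then {[]} else
     (if k = 0 then {} else (#) Zero ` zero_one_words n (k - 1)) \<union>
     (if n = 0 then {} else (#) One ` zero_one_words (n - 1) k))" for v
  proof (cases v)
    case Nil
    then show ?thesis by (auto simp: zero_one_words_def)
  next
    case (Cons x u)
    then show ?thesis by (cases x) (auto simp: zero_one_words_def image_iff)
  qed
qed

definition path_sum :: "(nat \<Rightarrow> 'a::comm_semiring_1) \<Rightarrow> nat \<Rightarrow> nat \<Rightarrow> nat \<Rightarrow> 'a" where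
  "path_sum c j n k = (\<Sum>v \<in> zero_one_words n k. path_weight c j v)"

lemma path_sum_rec:
  "path_sum c j n k = (if n = 0 \<and> k = 0 then 1 else
     (if k = 0 then 0 else c j * path_sum c j n (k - 1)) +
     (if n = 0 then 0 else path_sum c (Suc j) (n - 1) k))"
proof (cases "n = 0 \<and> k = 0")
  case True
  then show ?thesis by (simp add: path_sum_def zero_one_words_rec[of 0 0])
next
  case False
  let ?A = "if k = 0 then {} else (#) Zero ` zero_one_words n (k - 1)"
  let ?B = "if n = 0 then {} else (#) One ` zero_one_words (n - 1) k"
  have "zero_one_words n k = ?A \<union> ?B"
    using False by (subst zero_one_words_rec) simp
  then have "path_sum c j n k = sum (path_weight c j) ?A + sum (path_weight c j) ?B"
    unfolding path_sum_def
    by (simp only:) (rule sum.union_disjoint, auto simp: finite_zero_one_words)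
  moreover have "sum (path_weight c j) ((#) Zero ` zero_one_words n (k - 1)) =
      c j * path_sum c j n (k - 1)"
    by (simp add: path_sum_def sum.reindex sum_distrib_left)
  moreover have "sum (path_weight c j) ((#) One ` zero_one_words (n - 1) k) =
      path_sum c (Suc j) (n - 1) k"
    by (simp add: path_sum_def sum.reindex)
  ultimately show ?thesis using False by auto
qed

text \<open>The factor has constant coefficient 1, hence is a unit and can be cancelled.\<close>

lemma fps_eq_geometric_mult:
  fixes f h :: "'a::field fps"
  assumes "f * (1 - fps_const a * fps_X) = h"
  shows "f = 1 / (1 - fps_const a * fps_X) * h"
proof -
  let ?d = "1 - fps_const a * fps_X"
  have d: "fps_nth ?d 0 \<noteq> 0" by simp
  have "f = (inverse ?d * ?d) * f"
    by (simp only: inverse_mult_eq_1[OF d] mult_1)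
  also have "\<dots> = inverse ?d * h"
    by (simp only: assms[symmetric] mult_ac)
  also have "inverse ?d = 1 / ?d"
    by (simp only: fps_divide_unit[OF d] mult_1)
  finally show ?thesis .
qed

lemma path_gf_rec:
  fixes c :: "nat \<Rightarrow> 'a::field"
  shows "Abs_fps (path_sum c j n) = 1 / (1 - fps_const (c j) * fps_X) *
    (if n = 0 then 1 else Abs_fps (path_sum c (Suc j) (n - 1)))"
proof (rule fps_eq_geometric_mult, rule fps_ext)
  fix k
  \<comment> \<open>In this form the coefficient at \<open>k\<close> is
    \<open>path_sum c j n k\<close> minus \<open>c j\<close> times its predecessor (0 if
    \<open>k = 0\<close>), so \<open>path_sum_rec\<close> leaves only the paths starting with
    \<open>One\<close>, or the empty path.\<close>
  have "Abs_fps (path_sum c j n) * (1 - fps_const (c j) * fps_X) =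
      Abs_fps (path_sum c j n) - fps_const (c j) * (Abs_fps (path_sum c j n) * fps_X)"
    by (simp add: algebra_simps)
  then show "fps_nth (Abs_fps (path_sum c j n) * (1 - fps_const (c j) * fps_X)) k =
      fps_nth (if n = 0 then 1 else Abs_fps (path_sum c (Suc j) (n - 1))) k"
    using path_sum_rec[of c j n k] by (auto split: if_splits)
qed

text \<open>Each use of the recursion peels off the factor \<open>i = 0\<close> and raises the start
  to \<open>Suc j\<close>, so the induction needs \<open>j\<close> arbitrary.\<close>

lemma path_gf:
  fixes c :: "nat \<Rightarrow> 'a::field"
  shows "Abs_fps (path_sum c j n) = (\<Prod>i = 0..n. 1 / (1 - fps_const (c (j + i)) * fps_X))"
proof (induction n arbitrary: j)
  case 0
  then show ?case by (subst path_gf_rec) simp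
next
  case (Suc n)
  then show ?case
    by (subst path_gf_rec) (simp add: prod.atLeast0_atMost_Suc_shift del: prod.cl_ivl_Suc)
qed

text \<open>The height in front of index \<open>i\<close> is \<open>j\<close> plus the number of
  \<open>One\<close>s in the prefix. This explicit form can be matched with \<open>weight\<close>
  factor by factor.\<close>

lemma path_weight_eq_prod:
  "path_weight c j v =
     (\<Prod>i<length v. if v ! i = Zero then c (j + count_list (take i v) One) else 1)"
proof (induction v arbitrary: j)
  case (Cons x v)
  have "(\<Prod>i<length (x # v). if (x # v) ! i = Zero
          then c (j + count_list (take i (x # v)) One) else 1) =
      (if x = Zero then c j else 1) * (\<Prod>i<length v. if v ! i = Zero
          then c ((if x = One then Suc j else j) + count_list (take i v) One) else 1)"
    unfolding length_Cons prod.lessThan_Suc_shift by (auto intro!: arg_cong2[where f = times] prod.cong)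
  then show ?case by (simp add: Cons.IH)
qed simp

lemma count_list_eq_card: "count_list v a = card {i. i < length v \<and> v ! i = a}"
  by (simp add: count_list_eq_length_filter length_filter_conv_card eq_commute)

text \<open>The offset 2 combines the leading letter with the numbering from 1: index
  \<open>m\<close> of \<open>v\<close> is position \<open>m + 2\<close> of
  \<open>x # v\<close>.\<close>

lemma ones_before_Cons:
  assumes "m \<le> length v"
  shows "ones_before (x # v) (m + 2) = count_list (take m v) One"
proof -
  have "bij_betw (\<lambda>i. i + 2) {i. i < length (take m v) \<and> take m v ! i = One}
      {k \<in> {2..<m + 2}. letter_at (x # v) k = One}"
    using assms by (intro bij_betw_byWitness[where f' = "\<lambda>k. k - 2"])
      (auto simp: letter_at_def nth_Cons' numeral_2_eq_2)
  then show ?thesis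
    unfolding ones_before_def count_list_eq_card by (rule bij_betw_same_card[symmetric])
qed

lemma ones_after_Cons:
  assumes "m < length v"
  shows "ones_after (x # v) (m + 2) = count_list (drop (Suc m) v) One"
proof -
  \<comment> \<open>Index \<open>i\<close> after dropping \<open>Suc m\<close> letters is index
    \<open>m + 1 + i\<close> of \<open>v\<close>, hence position \<open>i + (m + 3)\<close> of
    \<open>x # v\<close>.\<close>
  have "bij_betw (\<lambda>i. i + (m + 3))
      {i. i < length (drop (Suc m) v) \<and> drop (Suc m) v ! i = One}
      {k \<in> {m + 2<..length (x # v)}. letter_at (x # v) k = One}"
    using assms by (intro bij_betw_byWitness[where f' = "\<lambda>k. k - (m + 3)"])
      (auto simp: letter_at_def nth_Cons' eval_nat_numeral add.commute Suc_diff_Suc)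
  then show ?thesis
    unfolding ones_after_def count_list_eq_card by (rule bij_betw_same_card[symmetric])
qed

lemma weight_Cons:
  "weight p q (x # v) = path_weight
     (\<lambda>j. 1 + real j * p + real (count_list v One - j) * q) 0 v"
proof -
  let ?c = "\<lambda>j. 1 + real j * p + real (count_list v One - j) * q"
  have "weight p q (x # v) =
      (\<Prod>m \<in> {m \<in> {..<length v}. v ! m = Zero}. ?c (count_list (take m v) One))"
    unfolding weight_def
  proof (rule prod.reindex_bij_witness[where i = "\<lambda>m. m + 2" and j = "\<lambda>i. i - 2"])
    fix i assume i: "i \<in> {i \<in> {2..length (x # v)}. letter_at (x # v) i = Zero}"
    define m where "m = i - 2"
    have m: "i = m + 2" "m < length v" "v ! m = Zero"
      using i by (auto simp: m_def letter_at_def nth_Cons' numeral_2_eq_2)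
    \<comment> \<open>Cutting \<open>v\<close> at its \<open>Zero\<close> shows that the
      \<open>One\<close>s before and after it add up to all of them, so the factor depends only on
      the height.\<close>
    have "count_list v One = count_list (take m v @ v ! m # drop (Suc m) v) One"
      using m(2) by (simp only: id_take_nth_drop[symmetric])
    also have "\<dots> = count_list (take m v) One + count_list (drop (Suc m) v) One"
      using m(3) by simp
    finally show "?c (count_list (take (i - 2) v) One) =
        1 + p * real (ones_before (x # v) i) + q * real (ones_after (x # v) i)"
      using m ones_before_Cons[of m v x] ones_after_Cons[of m v x] by (simp add: mult.commute)
  qed (auto simp: letter_at_def nth_Cons' numeral_2_eq_2)
  then show ?thesis
    by (simp only: path_weight_eq_prod prod.inter_filter[OF finite_lessThan] add_0)
qed

text \<open>The leading \<open>HatOne\<close> uses up the only one allowed, and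
  \<open>L = n + 1 + k\<close> turns the number \<open>L - n - 1\<close> of \<open>Zero\<close>s
  into \<open>k\<close>.\<close>

lemma Omega_HatOne_first:
  "{\<tau> \<in> Omega (n + 1 + k) n. letter_at \<tau> 1 = HatOne} = (#) HatOne ` zero_one_words n k"
proof (rule set_eqI)
  show "\<tau> \<in> {\<tau> \<in> Omega (n + 1 + k) n. letter_at \<tau> 1 = HatOne} \<longleftrightarrow>
      \<tau> \<in> (#) HatOne ` zero_one_words n k" for \<tau>
    by (cases \<tau>)
      (auto simp: Omega_def letter_at_def zero_one_words_def length_word split: if_splits)
qed

lemma restricted_pf_eq_path_sum:
  "restricted_pf p q (n + 1 + k) n =
     path_sum (\<lambda>j. 1 + real j * p + real (n - j) * q) 0 n k"
proof -
  have "restricted_pf p q (n + 1 + k) n =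
      (\<Sum>v \<in> zero_one_words n k. weight p q (HatOne # v))"
    unfolding restricted_pf_def Omega_HatOne_first by (simp add: sum.reindex)
  \<comment> \<open>All words in \<open>zero_one_words n k\<close> have \<open>n\<close> letters
    \<open>One\<close>, so the word-dependent weights of \<open>weight_Cons\<close> become one
    common function of the height.\<close>
  then show ?thesis
    by (simp add: path_sum_def weight_Cons zero_one_words_def)
qed

theorem theorem3p4:
  fixes p q :: real and n :: nat
  assumes "0 \<le> q" and "q \<le> p" and "p \<le> 1"
  shows "F p q n =
    (\<Prod>j = 0..n. 1 / (1 - fps_const (1 + real j * p + real (n - j) * q) * fps_X))"
  unfolding F_def restricted_pf_eq_path_sum path_gf by simp

end
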